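(* Let $y \sim \mathcal{N}(\mu,\sigma^2 I_n)$ and let $\hat E(y)=(\hat S,\hat s)$ be the selection event of marginal screening with model size $k$ (selected variables and signs). Then for every possible value $E=(S,s)$ of $\hat E(y)$ (with $\Pr(\hat E(y)=E)>0$), the distribution of $y$ conditional on the selection event is a constrained Gaussian: $$ y \,\big|\, \{\hat E(y)=E\} \ \overset{d}{=}\ z \,\big|\, \{A(S,s)z \le b(S,s)\}, \qquad z\sim \mathcal{N}(\mu,\sigma^2 I_n). $$
   Context: Setting: $X\in\mathbb{R}^{n\times p}$ is a fixed (non-random) design matrix with columns $x_1,\dots,x_p\in\mathbb{R}^n$ of unit Euclidean norm, in general position: any set of at most $\min(n,p)$ columns is linearly independent, and $x_i\neq\pm x_j$ for $i\ne j$. The response is $y=\mu+\epsilon$ with $\mu\in\mathbb{R}^n$ an arbitrary fixed vector and $\epsilon\sim\mathcal{N}(0,\sigma^2 I_n)$, $\sigma^2>0$ known. The model size $k$ is a fixed integer with $1\le k\le\min(n,p)$. Marginal screening: $\hat S=\hat S(y)\subset\{1,\dots,p\}$ is the set of indices of the $k$ largest entries of $(|x_1^Ty|,\dots,|x_p^Ty|)$, and $\hat s=\hat s(y)\in\{\pm1\}^{\hat S}$ is given by $\hat s_i=\mathrm{sign}(x_i^Ty)$, $i\in\hat S$. (Ties and zero correlations have probability zero and may be resolved arbitrarily.) Write $\hat E(y)=(\hat S(y),\hat s(y))$; its possible values are pairs $E=(S,s)$ with $|S|=k$, $s\in\{\pm1\}^S$. The matrix $A(S,s)$ and the vector $b(S,s)=0$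 encode the linear inequalities $$ s_i x_i^T y \ge x_j^Ty,\qquad s_ix_i^Ty\ge -x_j^Ty,\qquad s_ix_i^Ty\ge 0\qquad \text{for all } i\in S,\ j\notin S, $$ i.e. the rows of $A(S,s)$ are $(x_j-s_ix_i)^T$ and $(-x_j-s_ix_i)^T$ for $i\in S$, $j\notin S$, and $-s_ix_i^T$ for $i\in S$, so that these inequalities read $A(S,s)y\le b(S,s)$ (componentwise). *)

theory Defs
  imports "HOL-Probability.Probability"
begin

definition general_position :: "real ^ 'p ^ 'n \<Rightarrow> bool" where
  "general_position X \<longleftrightarrow>
     (\<forall>J. card J \<le> min CARD('n) CARD('p) \<longrightarrow> independent ((\<lambda>j. column j X) ` J)) \<and>
     (\<forall>i j. i \<noteq> j \<longrightarrow> column i X \<noteq> column j X \<and> column i X \<noteq> - column j X)"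

text \<open>Density of the Gaussian distribution with mean \<open>\<mu>\<close> and covariance matrix
  \<open>\<sigma>\<^sup>2\<close> times the identity; \<open>\<sigma>\<close> is the standard deviation, as in \<^const>\<open>normal_density\<close>.\<close>

definition isotropic_normal_density :: "real ^ 'n \<Rightarrow> real \<Rightarrow> real ^ 'n \<Rightarrow> real" where
  "isotropic_normal_density \<mu> \<sigma> v =
     1 / sqrt (2 * pi * \<sigma>\<^sup>2) ^ CARD('n) * exp (- (norm (v - \<mu>))\<^sup>2 / (2 * \<sigma>\<^sup>2))"

lemma isotropic_normal_density_eq_prod:
  "isotropic_normal_density \<mu> \<sigma> v = (\<Prod>i\<in>UNIV. normal_density (\<mu> $ i) \<sigma> (v $ i))"
proof -
  have "(norm (v - \<mu>))\<^sup>2 = (\<Sum>i\<in>UNIV. (v $ i - \<mu> $ i)\<^sup>2)"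
    by (simp only: power2_norm_eq_inner) (simp add: inner_vec_def power2_eq_square)
  then show ?thesis
    by (simp add: isotropic_normal_density_def normal_density_def prod_dividef
        exp_sum [symmetric] sum_negf sum_divide_distrib [symmetric])
qed

text \<open>\<open>marginal_screening X k Ehat\<close>: for every response \<open>y\<close>, \<open>Ehat y = (S, s)\<close> consists of the
  indices of \<open>k\<close> largest absolute correlations and of their signs. The predicate leaves the
  resolution of ties and the sign of a zero correlation open, so that it covers every
  convention. No measurability of \<open>Ehat\<close> is imposed: an outcome of positive probability is an
  event already, because \<^const>\<open>measure\<close> vanishes outside the sigma-algebra. A sign vector on \<open>S\<close> is an extensional function (\<^const>\<open>undefined\<close> outside \<open>S\<close>),
  so that equality of pairs \<open>(S, s)\<close> is equality of selection outcomes.\<close>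

definition marginal_screening ::
  "real ^ 'p ^ 'n \<Rightarrow> nat \<Rightarrow> (real ^ 'n \<Rightarrow> 'p set \<times> ('p \<Rightarrow> real)) \<Rightarrow> bool" where
  "marginal_screening X k Ehat \<longleftrightarrow>
     (\<forall>y S s. Ehat y = (S, s) \<longrightarrow>
        card S = k \<and>
        (\<forall>i\<in>S. \<forall>j\<in>- S. \<bar>column j X \<bullet> y\<bar> \<le> \<bar>column i X \<bullet> y\<bar>) \<and>
        s \<in> S \<rightarrow>\<^sub>E {-1, 1} \<and>
        (\<forall>i\<in>S. column i X \<bullet> y \<noteq> 0 \<longrightarrow> s i = sgn (column i X \<bullet> y)))"

text \<open>The number of rows of \<open>A(S,s)\<close> depends on \<open>S\<close>, so the matrix is a family of row
  vectors indexed by the finite set \<open>screening_rows S\<close>.\<close>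

datatype 'p screening_row = Pos_Row 'p 'p | Neg_Row 'p 'p | Sign_Row 'p

definition screening_rows :: "'p set \<Rightarrow> 'p screening_row set" where
  "screening_rows S =
     {Pos_Row i j | i j. i \<in> S \<and> j \<notin> S} \<union> {Neg_Row i j | i j. i \<in> S \<and> j \<notin> S} \<union> Sign_Row ` S"

fun screening_A ::
  "real ^ 'p ^ 'n \<Rightarrow> 'p set \<Rightarrow> ('p \<Rightarrow> real) \<Rightarrow> 'p screening_row \<Rightarrow> real ^ 'n" where
  "screening_A X S s (Pos_Row i j) = column j X - s i *\<^sub>R column i X"
| "screening_A X S s (Neg_Row i j) = - column j X - s i *\<^sub>R column i X"
| "screening_A X S s (Sign_Row i) = - (s i *\<^sub>R column i X)"

definition screening_b :: "'p set \<Rightarrow> ('p \<Rightarrow> real) \<Rightarrow> 'p screening_row \<Rightarrow> real" where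
  "screening_b S s r = 0"

lemma screening_A_le_b_iff:
  "(\<forall>r\<in>screening_rows S. screening_A X S s r \<bullet> y \<le> screening_b S s r) \<longleftrightarrow>
     (\<forall>i\<in>S. \<forall>j\<in>- S. s i * (column i X \<bullet> y) \<ge> column j X \<bullet> y \<and>
                      s i * (column i X \<bullet> y) \<ge> - (column j X \<bullet> y)) \<and>
     (\<forall>i\<in>S. s i * (column i X \<bullet> y) \<ge> 0)"
proof -
  have "(\<forall>r\<in>screening_rows S. P r) \<longleftrightarrow>
      (\<forall>i\<in>S. \<forall>j\<in>- S. P (Pos_Row i j) \<and> P (Neg_Row i j)) \<and> (\<forall>i\<in>S. P (Sign_Row i))" for P
    by (auto simp: screening_rows_def)
  then show ?thesis
    by (simp add: screening_b_def inner_diff_left add.commute)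
qed

text \<open>Distribution of \<open>Y\<close> conditional on the event \<open>Q\<close>; meaningful when \<open>Q\<close> is measurable and
  has positive probability.\<close>

definition conditional_law ::
  "'a measure \<Rightarrow> ('a \<Rightarrow> 'b :: topological_space) \<Rightarrow> ('a \<Rightarrow> bool) \<Rightarrow> 'b measure" where
  "conditional_law M Y Q = distr (uniform_measure M {\<omega> \<in> space M. Q \<omega>}) borel Y"

end

theory Submission imports Defs begin

text \<open>For every response, the selection event entails the linear inequalities. Conversely the
  inequalities determine the selected variables and signs unless a correlation vanishes or two
  absolute correlations tie, which confines the response to finitely many hyperplanes, proper
  because the columns are nonzero and pairwise distinct up to sign. These are Lebesgue-null, so the
  two events agree almost surely; and conditioning depends only on the law of the response and
  the event up to null sets.\<close>

text \<open>The condition mentions neither \<open>S\<close> nor \<open>s\<close>. Where it holds,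
  all conventions that \<open>marginal_screening\<close> permits give the same outcome.\<close>

definition untied :: "real ^ 'p ^ 'n \<Rightarrow> real ^ 'n \<Rightarrow> bool" where
  "untied X v \<longleftrightarrow> (\<forall>i. column i X \<bullet> v \<noteq> 0) \<and>
     (\<forall>i j. i \<noteq> j \<longrightarrow> \<bar>column i X \<bullet> v\<bar> \<noteq> \<bar>column j X \<bullet> v\<bar>)"

lemma AE_lborel_inner_neq_0:
  fixes a :: "'a::euclidean_space"
  assumes "a \<noteq> 0"
  shows "AE v in lborel. a \<bullet> v \<noteq> 0"
proof -
  \<comment> \<open>Negligibility refers to the completed measure; nullity passes down to
    \<open>lborel\<close> because a hyperplane is closed, hence Borel.\<close>
  have "{v. a \<bullet> v = 0} \<in> null_sets lebesgue"
    using negligible_hyperplane[of a 0] assms by (simp add: negligible_iff_null_sets)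
  moreover have "{v. a \<bullet> v = 0} \<in> sets lborel"
    by (simp add: closed_hyperplane borel_closed)
  ultimately have "{v. a \<bullet> v = 0} \<in> null_sets lborel"
    by (simp add: null_sets_completion_iff)
  then show ?thesis
    by (rule AE_I'[where N = "{v. a \<bullet> v = 0}"]) auto
qed

lemma AE_lborel_untied:
  fixes X :: "real ^ 'p ^ 'n"
  assumes "\<And>j. column j X \<noteq> 0"
    and "\<And>i j. i \<noteq> j \<Longrightarrow> column i X \<noteq> column j X \<and> column i X \<noteq> - column j X"
  shows "AE v in lborel. untied X v"
proof -
  have "AE v in lborel. \<forall>i\<in>UNIV. column i X \<bullet> v \<noteq> 0"
    by (intro AE_finite_allI AE_lborel_inner_neq_0 assms) auto
  \<comment> \<open>Two absolute values agree iff the numbers are equal or opposite, so each tie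
    lies in one of two hyperplanes, normal to the difference and to the sum of the two
    columns.\<close>
  moreover have "AE v in lborel. \<forall>q\<in>{q. fst q \<noteq> snd q}.
      (column (fst q) X - column (snd q) X) \<bullet> v \<noteq> 0 \<and>
      (column (fst q) X + column (snd q) X) \<bullet> v \<noteq> 0"
  proof (intro AE_finite_allI AE_conjI AE_lborel_inner_neq_0)
    fix q :: "'p \<times> 'p" assume "q \<in> {q. fst q \<noteq> snd q}"
    then show "column (fst q) X - column (snd q) X \<noteq> 0"
      and "column (fst q) X + column (snd q) X \<noteq> 0"
      using assms(2)[of "fst q" "snd q"] by (auto simp: eq_neg_iff_add_eq_0)
  qed auto
  ultimately show ?thesis
    by eventually_elim
      (auto simp: untied_def inner_diff_left inner_add_left abs_eq_iff eq_neg_iff_add_eq_0)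
qed

text \<open>This direction holds at every response: if a selected correlation vanishes, its product
  with either sign is still its absolute value, and ties are harmless for weak inequalities.\<close>

lemma screening_A_le_b_if_selected:
  assumes "marginal_screening X k Ehat" and "Ehat v = (S, s)"
  shows "\<forall>r\<in>screening_rows S. screening_A X S s r \<bullet> v \<le> screening_b S s r"
proof -
  note sel = assms(1)[unfolded marginal_screening_def, rule_format, OF assms(2)]
  have abs_eq: "s i * (column i X \<bullet> v) = \<bar>column i X \<bullet> v\<bar>" if "i \<in> S" for i
    using sel that by (cases "column i X \<bullet> v = 0") (auto simp: abs_sgn mult.commute)
  show ?thesis
    unfolding screening_A_le_b_iff using sel by (simp add: abs_eq abs_le_iff)
qed

text \<open>The sign rows force each \<open>s i\<close> to be the sign of a nonzero correlation. The
  other rows then compare absolute values, strictly for lack of ties, so \<open>S\<close> is the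
  only possible set of \<open>k\<close> largest ones.\<close>

lemma selected_if_screening_A_le_b:
  assumes scr: "marginal_screening X k Ehat" and "untied X v"
    and "card S = k" and s: "s \<in> S \<rightarrow>\<^sub>E {-1, 1}"
    and le: "\<forall>r\<in>screening_rows S. screening_A X S s r \<bullet> v \<le> screening_b S s r"
  shows "Ehat v = (S, s)"
proof -
  obtain S' s' where E: "Ehat v = (S', s')" by fastforce
  note sel = scr[unfolded marginal_screening_def, rule_format, OF E]
  have nz: "column i X \<bullet> v \<noteq> 0" for i
    using assms(2) by (auto simp: untied_def)
  have abs_eq: "s i * (column i X \<bullet> v) = \<bar>column i X \<bullet> v\<bar>" and sgn: "s i = sgn (column i X \<bullet> v)"
    if "i \<in> S" for i
  proof -
    have "s i = -1 \<or> s i = 1" using s that by auto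
    moreover have "s i * (column i X \<bullet> v) \<ge> 0"
      using le that unfolding screening_A_le_b_iff by auto
    ultimately show "s i * (column i X \<bullet> v) = \<bar>column i X \<bullet> v\<bar>" "s i = sgn (column i X \<bullet> v)"
      using nz[of i] by (auto simp: sgn_if)
  qed
  have less: "\<bar>column j X \<bullet> v\<bar> < \<bar>column i X \<bullet> v\<bar>" if "i \<in> S" "j \<notin> S" for i j
  proof -
    have "\<bar>column j X \<bullet> v\<bar> \<le> \<bar>column i X \<bullet> v\<bar>"
      using le that unfolding screening_A_le_b_iff by (auto simp: abs_eq abs_le_iff)
    moreover have "i \<noteq> j" using that by auto
    ultimately show ?thesis
      using assms(2) unfolding untied_def by force
  qed
  \<comment> \<open>Distinct sets of equal size each have an element outside the other. For such a
    pair, selection of \<open>S'\<close> puts \<open>j\<close> at least as high as \<open>i\<close>,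
    against \<open>less\<close>.\<close>
  have "S' = S"
  proof (rule ccontr)
    assume "S' \<noteq> S"
    moreover have "card S' = card S" using sel assms(3) by simp
    ultimately have "\<not> S \<subseteq> S'" and "\<not> S' \<subseteq> S"
      by (metis card_subset_eq finite)+
    then obtain i j where "i \<in> S" "i \<notin> S'" "j \<in> S'" "j \<notin> S" by blast
    then show False
      using sel less[of i j] by force
  qed
  moreover have "s' = s"
  \<comment> \<open>Outside \<open>S\<close> both functions are \<open>undefined\<close>, so
    agreement on \<open>S\<close> suffices.\<close>
  proof (rule PiE_ext)
    show "s' \<in> S \<rightarrow>\<^sub>E {-1, 1}" using sel \<open>S' = S\<close> by simp
    show "s' i = s i" if "i \<in> S" for i
      using sel nz that sgn \<open>S' = S\<close> by simp
  qed (rule s)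
  ultimately show ?thesis using E by simp
qed

lemma uniform_measure_cong_AE:
  assumes "A \<in> sets M" "B \<in> sets M" "AE x in M. x \<in> A \<longleftrightarrow> x \<in> B"
  shows "uniform_measure M A = uniform_measure M B"
proof (rule measure_eqI)
  fix C assume C: "C \<in> sets (uniform_measure M A)"
  have "emeasure M A = emeasure M B"
    using assms by (intro emeasure_eq_AE)
  moreover have "emeasure M (A \<inter> C) = emeasure M (B \<inter> C)"
    using assms C by (intro emeasure_eq_AE) auto
  ultimately show "emeasure (uniform_measure M A) C = emeasure (uniform_measure M B) C"
    using assms C by simp
qed simp

text \<open>Conditioning on a preimage commutes with pushing forward, since preimages preserve
  intersections.\<close>

lemma uniform_measure_distr:
  assumes [measurable]: "f \<in> measurable M N" "C \<in> sets N"
  shows "distr (uniform_measure M (f -` C \<inter> space M)) N f = uniform_measure (distr M N f) C"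
proof (rule measure_eqI)
  fix B assume "B \<in> sets (distr (uniform_measure M (f -` C \<inter> space M)) N f)"
  then have [measurable]: "B \<in> sets N" by simp
  have "f -` C \<inter> space M \<inter> (f -` B \<inter> space M) = f -` (C \<inter> B) \<inter> space M"
    by auto
  then show "emeasure (distr (uniform_measure M (f -` C \<inter> space M)) N f) B =
      emeasure (uniform_measure (distr M N f) C) B"
    by (simp add: emeasure_distr)
qed simp

text \<open>The right-hand side depends only on \<open>f\<close> and \<open>C\<close>, so it serves
  as a common value for responses living on different probability spaces.\<close>

lemma conditional_law_eq_uniform_measure:
  assumes D: "distributed M lborel Y f" and C: "C \<in> sets borel"
    and Q: "{\<omega> \<in> space M. Q \<omega>} \<in> sets M" and AE: "AE \<omega> in M. Q \<omega> \<longleftrightarrow> Y \<omega> \<in> C"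
  shows "conditional_law M Y Q = uniform_measure (density lborel f) C"
proof -
  have Y: "Y \<in> measurable M lborel"
    using D by (rule distributed_measurable)
  have "uniform_measure M {\<omega> \<in> space M. Q \<omega>} = uniform_measure M (Y -` C \<inter> space M)"
    using AE by (intro uniform_measure_cong_AE Q measurable_sets[OF Y]) (auto simp: C)
  \<comment> \<open>The target changes from \<open>borel\<close> to \<open>lborel\<close>:
    \<open>distr\<close> uses only the sigma-algebra of its target, and the two coincide.\<close>
  then have "conditional_law M Y Q = distr (uniform_measure M (Y -` C \<inter> space M)) lborel Y"
    unfolding conditional_law_def by (intro distr_cong) auto
  also have "\<dots> = uniform_measure (density lborel f) C"
    using C by (simp add: uniform_measure_distr[OF Y] distributed_distr_eq_density[OF D])
  finally show ?thesis .
qed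

text \<open>A law with a density is absolutely continuous, so null sets of the reference measure
  remain null under \<open>Y\<close>.\<close>

lemma AE_distributed:
  assumes "distributed M N Y f" "AE v in N. P v"
  shows "AE \<omega> in M. P (Y \<omega>)"
proof -
  have "AE v in distr M N Y. P v"
    unfolding distributed_distr_eq_density[OF assms(1)]
    using assms by (subst AE_density) (auto simp: distributed_borel_measurable)
  then show ?thesis
    using distributed_measurable[OF assms(1)] by (rule AE_distrD[rotated])
qed

theorem theorem4p1:
  fixes X :: "real ^ 'p ^ 'n" and \<mu> :: "real ^ 'n" and \<sigma> :: real and k :: nat
    and Ehat :: "real ^ 'n \<Rightarrow> 'p set \<times> ('p \<Rightarrow> real)"
    and M :: "'a measure" and y :: "'a \<Rightarrow> real ^ 'n"
    and N :: "'b measure" and z :: "'b \<Rightarrow> real ^ 'n"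
    and S :: "'p set" and s :: "'p \<Rightarrow> real"
  assumes "\<And>j. norm (column j X) = 1"
    and "general_position X"
    and "1 \<le> k" and "k \<le> min CARD('n) CARD('p)"
    and "\<sigma> > 0"
    and "marginal_screening X k Ehat"
    and "prob_space M" and "distributed M lborel y (isotropic_normal_density \<mu> \<sigma>)"
    and "prob_space N" and "distributed N lborel z (isotropic_normal_density \<mu> \<sigma>)"
    and "measure M {\<omega> \<in> space M. Ehat (y \<omega>) = (S, s)} > 0"
  shows "conditional_law M y (\<lambda>\<omega>. Ehat (y \<omega>) = (S, s)) =
         conditional_law N z
           (\<lambda>\<omega>. \<forall>r\<in>screening_rows S. screening_A X S s r \<bullet> z \<omega> \<le> screening_b S s r)"
proof -
  define C where
    "C = {v. \<forall>r\<in>screening_rows S. screening_A X S s r \<bullet> v \<le> screening_b S s r}"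
  have "closed C"
    unfolding C_def Ball_def by (intro closed_Collect_all closed_Collect_imp)
      (auto intro!: closed_Collect_le continuous_intros)
  then have C: "C \<in> sets borel" by (rule borel_closed)
  \<comment> \<open>\<open>measure\<close> is 0 outside the sigma-algebra, so positive probability
    yields measurability.\<close>
  have E: "{\<omega> \<in> space M. Ehat (y \<omega>) = (S, s)} \<in> sets M"
    using assms(11) measure_notin_sets by fastforce
  \<comment> \<open>Positive probability also means that the outcome is attained, which makes
    \<open>s\<close> a sign vector on a set \<open>S\<close> of size \<open>k\<close>, as the
    converse inclusion requires.\<close>
  have "{\<omega> \<in> space M. Ehat (y \<omega>) = (S, s)} \<noteq> {}"
    using assms(11) by (metis less_irrefl measure_empty)
  then obtain v0 where "Ehat v0 = (S, s)" by auto
  then have S: "card S = k" and s: "s \<in> S \<rightarrow>\<^sub>E {-1, 1}"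
    using assms(6) unfolding marginal_screening_def by blast+
  have "column j X \<noteq> 0" for j
    using assms(1)[of j] by auto
  then have "AE v in lborel. untied X v"
    using assms(2) by (intro AE_lborel_untied) (auto simp: general_position_def)
  then have "AE v in lborel. Ehat v = (S, s) \<longleftrightarrow> v \<in> C"
  proof eventually_elim
    case (elim v)
    then show ?case
      using screening_A_le_b_if_selected[OF assms(6)]
        selected_if_screening_A_le_b[OF assms(6) _ S s] by (auto simp: C_def)
  qed
  then have "AE \<omega> in M. Ehat (y \<omega>) = (S, s) \<longleftrightarrow> y \<omega> \<in> C"
    by (rule AE_distributed[OF assms(8)])
  then have "conditional_law M y (\<lambda>\<omega>. Ehat (y \<omega>) = (S, s)) =
      uniform_measure (density lborel (isotropic_normal_density \<mu> \<sigma>)) C"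
    by (rule conditional_law_eq_uniform_measure[OF assms(8) C E])
  moreover have "{\<omega> \<in> space N. z \<omega> \<in> C} \<in> sets N"
    using measurable_sets[OF distributed_measurable[OF assms(10)], of C] C
    by (simp add: vimage_def Collect_conj_eq Int_commute)
  \<comment> \<open>For \<open>z\<close> the conditioning event is the preimage of \<open>C\<close>
    itself, so the almost sure equivalence is trivial.\<close>
  then have "conditional_law N z (\<lambda>\<omega>. z \<omega> \<in> C) =
      uniform_measure (density lborel (isotropic_normal_density \<mu> \<sigma>)) C"
    by (intro conditional_law_eq_uniform_measure[OF assms(10) C]) auto
  ultimately show ?thesis
    by (simp add: C_def)
qed

end
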